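(* Let $(f_n)_{n\geq 0}$ be the Fibonacci sequence and $(\lambda_n)_{n\geq 0}$ its Lucas companion: $f_0=0$, $f_1=1$, $f_{n+2}=f_{n+1}+f_n$, and $\lambda_0=2$, $\lambda_1=1$, $\lambda_{n+2}=\lambda_{n+1}+\lambda_n$. Suppose that $\ell$ is an odd prime with $\ell\neq 5$. Let $\alpha_\ell\geq 1$ be the smallest index such that $\ell\mid f_{\alpha_\ell}$, and set $$\rho_\ell=\frac{\alpha_\ell}{\gcd(\alpha_\ell,2)}\quad\text{and}\quad r_\ell=v_\ell(f_{\alpha_\ell}).$$ Set $h_\ell=1$ if $\ell=3$, and $h_\ell=0$ otherwise. Then $$v_\ell\left(f_{2\ell\rho_\ell}-\ell f_{2\rho_\ell}\right)=3r_\ell+1-h_\ell\quad\text{and}\quad v_\ell\left(\lambda_{2\ell\rho_\ell}-\lambda_{2\rho_\ell}\right)=2r_\ell.$$ Therefore, $$\begin{aligned}\ell\text{ is a Wall--Sun--Sun prime}\quad&\Longleftrightarrow\quad\ell^{7-h_\ell}\mid f_{2\ell\rho_\ell}-\ell f_{2\rho_\ell}\quad\Longleftrightarrow\quad\ell^4\mid\lambda_{2\ell\rho_\ell}-\lambda_{2\rho_\ell}\\&\Longleftrightarrow\quad\ell^{5-h_\ell}\mid f_{2\ell\rho_\ell}-\ell f_{2\rho_\ell}\quad\Longleftrightarrow\quad\ell^3\mid\lambda_{2\ell\rho_\ell}-\lambda_{2\rho_\ell},\end{aligned}$$ and $$r_\ell=\frac{v_\ell(f_{2\ell\rho_\ell}-\ell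 f_{2\rho_\ell})+h_\ell-1}{3}=\frac{v_\ell(\lambda_{2\ell\rho_\ell}-\lambda_{2\rho_\ell})}{2}.$$
   Context: $v_\ell$ denotes the usual $\ell$-adic valuation on $\mathbb{Q}$, with $v_\ell(0)=\infty$. For a positive integer $m$, let $\pi(m)$ be the (least) period of the sequence $(f_n \bmod m)_{n\geq 0}$ (the Pisano period). A rational prime $\ell$ is called a Wall–Sun–Sun prime if $\pi(\ell^2)=\pi(\ell)$. *)

theory Defs
  imports "HOL-Number_Theory.Number_Theory" "HOL-Library.Extended_Real"
begin

text \<open>The Fibonacci sequence is the library function \<^const>\<open>fib\<close>.\<close>

fun lucas :: "nat \<Rightarrow> nat" where
  "lucas 0 = 2"
| "lucas (Suc 0) = 1"
| "lucas (Suc (Suc n)) = lucas (Suc n) + lucas n"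

text \<open>
  The library's \<^const>\<open>multiplicity\<close> sends \<open>0\<close> to \<open>0\<close>, whereas the valuation sends \<open>0\<close> to
  \<open>\<infinity>\<close>; values are therefore taken in the extended reals. The function
  \<^const>\<open>quotient_of\<close> returns the numerator and the positive denominator in lowest terms.
\<close>

definition val :: "nat \<Rightarrow> rat \<Rightarrow> ereal" where
  "val p x =
     (if x = 0 then \<infinity>
      else ereal (real (multiplicity (int p) (fst (quotient_of x)))
                  - real (multiplicity (int p) (snd (quotient_of x)))))"

text \<open>
  Since \<open>(f\<^sub>n mod m)\<close> is purely periodic, the least period is taken from index \<open>0\<close> on.
\<close>

definition pisano :: "nat \<Rightarrow> nat" where
  "pisano m = (LEAST t. t \<ge> 1 \<and> (\<forall>n. [fib (n + t) = fib n] (mod m)))"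

definition wall_sun_sun_prime :: "nat \<Rightarrow> bool" where
  "wall_sun_sun_prime p \<longleftrightarrow> prime p \<and> pisano (p ^ 2) = pisano p"

text \<open>The index \<open>\<alpha>\<^sub>p\<close>; such an index exists for every \<open>p \<ge> 1\<close>.\<close>

definition fib_rank :: "nat \<Rightarrow> nat" where
  "fib_rank p = (LEAST n. n \<ge> 1 \<and> p dvd fib n)"

end

theory Submission
  imports Defs
begin

text \<open>
  Put \<open>m = 2\<rho>\<close>, which is \<open>\<alpha>\<close> or \<open>2\<alpha>\<close>; since \<open>l\<close> does not divide \<open>\<lambda>\<^sub>\<alpha>\<close>, the valuation of \<open>f\<^sub>m\<close> is \<open>r\<close>.
  As \<open>m\<close> is even, Binet's formulas give for \<open>l = 2s + 1\<close> the factorisations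
  \<open>F = 5 f\<^sub>m (f\<^sub>m\<^sup>2 + f\<^sub>2\<^sub>m\<^sup>2 + \<dots> + f\<^sub>s\<^sub>m\<^sup>2)\<close> and \<open>L = 5 f\<^bsub>(s+1)m\<^esub> f\<^bsub>sm\<^esub>\<close>.
  Moreover \<open>f\<^sub>j\<^sub>m\<^sup>2 / f\<^sub>m\<^sup>2\<close> is congruent to \<open>j\<^sup>2\<close> modulo \<open>f\<^sub>m\<^sup>2\<close>, hence modulo \<open>l\<^sup>2\<close>, so that both factors
  of \<open>L\<close> have valuation \<open>r\<close> and that of \<open>F\<close> is \<open>3r\<close> plus that of
  \<open>1\<^sup>2 + \<dots> + s\<^sup>2 = l (l\<^sup>2 - 1) / 24\<close>, which is \<open>1\<close> for \<open>l > 5\<close> and \<open>0\<close> for \<open>l = 3\<close>.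

  By Cassini's identity \<open>4\<alpha>\<close> is a period modulo \<open>l\<close>. If \<open>\<pi>(l\<^sup>2) = \<pi>(l)\<close> then
  \<open>l\<^sup>2\<close> divides \<open>f\<^bsub>\<pi>(l)\<^esub>\<close> and so \<open>f\<^bsub>4\<alpha>\<^esub> = f\<^bsub>\<alpha>\<^esub> \<lambda>\<^bsub>\<alpha>\<^esub> \<lambda>\<^bsub>2\<alpha>\<^esub>\<close>, whence \<open>l\<^sup>2\<close> divides \<open>f\<^bsub>\<alpha>\<^esub>\<close>. The converse lifts
  the period \<open>\<pi>(l)\<close> from \<open>l\<close> to \<open>l\<^sup>2\<close>.
\<close>

section \<open>Fibonacci and Lucas identities from Binet's formulas\<close>

lemma binet:
  obtains \<phi> \<psi> :: real where "\<phi> * \<psi> = -1"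
    "\<And>n. real (fib n) = (\<phi> ^ n - \<psi> ^ n) / sqrt 5" "\<And>n. real (lucas n) = \<phi> ^ n + \<psi> ^ n"
proof -
  define \<phi> \<psi> :: real where "\<phi> = (1 + sqrt 5) / 2" and "\<psi> = (1 - sqrt 5) / 2"
  have sq: "\<phi>\<^sup>2 = \<phi> + 1" "\<psi>\<^sup>2 = \<psi> + 1"
    by (simp_all add: \<phi>_def \<psi>_def power2_eq_square field_simps)
  have "real (lucas n) = \<phi> ^ n + \<psi> ^ n" for n
  proof (induction n rule: lucas.induct)
    case (3 n)
    have "\<phi> ^ Suc (Suc n) = \<phi> ^ n * \<phi>\<^sup>2" "\<psi> ^ Suc (Suc n) = \<psi> ^ n * \<psi>\<^sup>2"
      by (simp_all add: power2_eq_square)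
    then show ?case
      using 3 by (simp add: sq algebra_simps)
  qed (simp_all add: \<phi>_def \<psi>_def field_simps)
  moreover have "\<phi> * \<psi> = -1"
    by (simp add: \<phi>_def \<psi>_def field_simps)
  moreover have "real (fib n) = (\<phi> ^ n - \<psi> ^ n) / sqrt 5" for n
    unfolding \<phi>_def \<psi>_def by (rule fib_closed_form)
  ultimately show thesis
    using that by blast
qed

lemma fib_double: "fib (2 * n) = fib n * lucas n"
proof -
  obtain \<phi> \<psi> :: real where *: "\<And>n. real (fib n) = (\<phi> ^ n - \<psi> ^ n) / sqrt 5"
    "\<And>n. real (lucas n) = \<phi> ^ n + \<psi> ^ n"
    using binet by metis
  have "real (fib (2 * n)) = real (fib n * lucas n)"
    unfolding of_nat_mult * mult_2 power_add by (simp add: field_simps)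
  then show ?thesis
    by (simp only: of_nat_eq_iff)
qed

lemma lucas_squared: "(int (lucas n))\<^sup>2 = 5 * (int (fib n))\<^sup>2 + 4 * (-1) ^ n"
proof -
  obtain \<phi> \<psi> :: real where *: "\<phi> * \<psi> = -1" "\<And>n. real (fib n) = (\<phi> ^ n - \<psi> ^ n) / sqrt 5"
    "\<And>n. real (lucas n) = \<phi> ^ n + \<psi> ^ n"
    using binet by metis
  have "(-1) ^ n = \<phi> ^ n * \<psi> ^ n"
    by (simp flip: *(1) power_mult_distrib)
  then have "real_of_int ((int (lucas n))\<^sup>2) = real_of_int (5 * (int (fib n))\<^sup>2 + 4 * (-1) ^ n)"
    by (simp add: *(2,3) power2_eq_square field_simps)
  then show ?thesis
    by (simp only: of_int_eq_iff)
qed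

text \<open>For even \<open>y\<close> the product \<phi>^y * \<psi>^y is 1, so the cross terms on
  the right-hand sides reduce to terms of index \<open>d\<close>.\<close>

lemma
  assumes "even y"
  shows fib_add_double: "fib (d + 2 * y) = fib d + fib y * lucas (d + y)"
    and lucas_add_double: "lucas (d + 2 * y) = lucas d + 5 * fib (d + y) * fib y"
    and lucas_add_double': "lucas (d + 2 * y) + lucas d = lucas y * lucas (d + y)"
proof -
  obtain \<phi> \<psi> :: real where *: "\<phi> * \<psi> = -1" "\<And>n. real (fib n) = (\<phi> ^ n - \<psi> ^ n) / sqrt 5"
    "\<And>n. real (lucas n) = \<phi> ^ n + \<psi> ^ n"
    using binet by metis
  have 1: "\<phi> ^ y * \<psi> ^ y = 1"
    using assms by (simp add: *(1) flip: power_mult_distrib)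
  have "\<phi> ^ y * (\<psi> ^ y * z) = z" "\<psi> ^ y * (\<phi> ^ y * z) = z" for z
    using 1 by (metis mult.assoc mult.commute mult_1)+
  note [simp] = 1 this
  have "real (fib (d + 2 * y)) = real (fib d + fib y * lucas (d + y))"
    unfolding of_nat_add of_nat_mult *(2,3) mult_2 power_add by (simp add: field_simps)
  then show "fib (d + 2 * y) = fib d + fib y * lucas (d + y)"
    by (simp only: of_nat_eq_iff)
  have "real (lucas (d + 2 * y)) = real (lucas d + 5 * fib (d + y) * fib y)"
    unfolding of_nat_add of_nat_mult *(2,3) mult_2 power_add by (simp add: field_simps)
  then show "lucas (d + 2 * y) = lucas d + 5 * fib (d + y) * fib y"
    by (simp only: of_nat_eq_iff)
  have "real (lucas (d + 2 * y) + lucas d) = real (lucas y * lucas (d + y))"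
    unfolding of_nat_add of_nat_mult *(2,3) mult_2 power_add by (simp add: field_simps)
  then show "lucas (d + 2 * y) + lucas d = lucas y * lucas (d + y)"
    by (simp only: of_nat_eq_iff)
qed

lemma lucas_double: "even n \<Longrightarrow> lucas (2 * n) = 2 + 5 * (fib n)\<^sup>2"
  using lucas_add_double[of n 0] by (simp add: power2_eq_square)

text \<open>Raising \<open>s\<close> by one adds \<open>fib m * lucas (2 * (s + 1) * m)\<close>, and
  \<open>lucas_double\<close> turns the Lucas factor into 2 plus five times a square.\<close>

lemma fib_odd_multiple:
  assumes "even m"
  shows "fib ((2 * s + 1) * m) = fib m * (2 * s + 1 + 5 * (\<Sum>j=1..s. (fib (j * m))\<^sup>2))"
proof (induction s)
  case (Suc s)
  have "(2 * Suc s + 1) * m = (2 * s + 1) * m + 2 * m" "(2 * s + 1) * m + m = 2 * (Suc s * m)"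
    by (simp_all add: algebra_simps)
  then have "fib ((2 * Suc s + 1) * m) = fib ((2 * s + 1) * m) + fib m * lucas (2 * (Suc s * m))"
    using fib_add_double[OF assms, of "(2 * s + 1) * m"] by metis
  then show ?case
    unfolding Suc.IH using lucas_double[of "Suc s * m"] assms by (simp add: algebra_simps)
qed simp

lemma lucas_odd_multiple:
  assumes "even m"
  shows "lucas ((2 * s + 1) * m) = lucas m + 5 * fib ((s + 1) * m) * fib (s * m)"
proof -
  have "(2 * s + 1) * m = m + 2 * (s * m)" "(s + 1) * m = m + s * m"
    by (simp_all add: algebra_simps)
  then show ?thesis
    using assms lucas_add_double[of "s * m" m] by (simp only: dvd_mult)
qed

text \<open>
  The numbers \<open>fib (j * m)\<^sup>2\<close> satisfy a recurrence that is \<open>x\<^sub>j\<^sub>+\<^sub>2 = 2 x\<^sub>j\<^sub>+\<^sub>1 - x\<^sub>j + 2 (fib m)\<^sup>2\<close>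
  modulo \<open>(fib m)\<^sup>4\<close>, as is that of \<open>j\<^sup>2 (fib m)\<^sup>2\<close>.
\<close>

lemma fib_multiple_squared:
  assumes "even m"
  shows "\<exists>c. (int (fib (j * m)))\<^sup>2 = (int (fib m))\<^sup>2 * ((int j)\<^sup>2 + c * (int (fib m))\<^sup>2)"
proof (induction j rule: induct_nat_012)
  case 0
  show ?case by (simp add: exI[of _ 0])
next
  case 1
  show ?case by (simp add: exI[of _ 0])
next
  case (ge2 j)
  define f where "f = int (fib m)"
  define E where "E i = (int (fib (i * m)))\<^sup>2" for i
  obtain c c' where c: "E j = f\<^sup>2 * ((int j)\<^sup>2 + c * f\<^sup>2)"
    and c': "E (Suc j) = f\<^sup>2 * ((int (Suc j))\<^sup>2 + c' * f\<^sup>2)"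
    using ge2 unfolding E_def f_def by blast
  have L: "int (lucas (2 * (i * m))) = 2 + 5 * E i" for i
    using lucas_double[of "i * m"] assms by (simp add: E_def)
  have "2 * (j * m) + 2 * (2 * m) = 2 * (Suc (Suc j) * m)" "2 * (j * m) + 2 * m = 2 * (Suc j * m)"
    by (simp_all add: algebra_simps)
  then have "lucas (2 * (Suc (Suc j) * m)) + lucas (2 * (j * m)) = lucas (2 * m) * lucas (2 * (Suc j * m))"
    using lucas_add_double'[of "2 * m" "2 * (j * m)"] by (metis dvd_triv_left)
  then have "int (lucas (2 * (Suc (Suc j) * m))) + int (lucas (2 * (j * m)))
      = int (lucas (2 * (1 * m))) * int (lucas (2 * (Suc j * m)))"
    by (simp only: mult_1 flip: of_nat_add of_nat_mult)
  then have "(2 + 5 * E (Suc (Suc j))) + (2 + 5 * E j) = (2 + 5 * f\<^sup>2) * (2 + 5 * E (Suc j))"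
    unfolding L by (simp add: E_def f_def)
  then have "E (Suc (Suc j)) = 2 * E (Suc j) - E j + 5 * f\<^sup>2 * E (Suc j) + 2 * f\<^sup>2"
    by (simp add: algebra_simps)
  also have "\<dots> = f\<^sup>2 * ((int (Suc (Suc j)))\<^sup>2 + (2 * c' - c + 5 * ((int (Suc j))\<^sup>2 + c' * f\<^sup>2)) * f\<^sup>2)"
    unfolding c c' by (simp add: power2_eq_square algebra_simps)
  finally show ?case
    unfolding E_def f_def by blast
qed

section \<open>Periods modulo m and the rank of apparition\<close>

lemma fib_period_iff:
  "(\<forall>n. [fib (n + t) = fib n] (mod m)) \<longleftrightarrow> [fib t = 0] (mod m) \<and> [fib (Suc t) = 1] (mod m)"
proof (intro iffI allI)
  assume *: "\<forall>n. [fib (n + t) = fib n] (mod m)"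
  show "[fib t = 0] (mod m) \<and> [fib (Suc t) = 1] (mod m)"
    using spec[OF *, of 0] spec[OF *, of 1] by simp
next
  fix n
  assume *: "[fib t = 0] (mod m) \<and> [fib (Suc t) = 1] (mod m)"
  show "[fib (n + t) = fib n] (mod m)"
  proof (cases n)
    case 0
    then show ?thesis using * by simp
  next
    case (Suc k)
    have "[fib (Suc t) * fib (Suc k) + fib t * fib k = 1 * fib (Suc k) + 0 * fib k] (mod m)"
      using * by (intro cong_add cong_mult cong_refl) auto
    then show ?thesis
      using fib_add[of k t] Suc by simp
  qed
qed

text \<open>By the pigeonhole principle some pair of consecutive residues recurs; the recurrence run
  backwards carries the coincidence down to index 0.\<close>

lemma fib_period_exists:
  assumes "m > 0"
  shows "\<exists>t\<ge>1. \<forall>n. [fib (n + t) = fib n] (mod m)"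
proof -
  define g where "g n = (fib n mod m, fib (Suc n) mod m)" for n
  have "range g \<subseteq> {..<m} \<times> {..<m}"
    using assms by (auto simp: g_def)
  then have "finite (range g)"
    by (rule finite_subset) auto
  then have "\<not> inj g"
    using finite_imageD infinite_UNIV_nat by blast
  then obtain i j where "g i = g j" "i < j"
    unfolding inj_on_def by (metis linorder_neqE_nat)
  moreover define t where "t = j - i"
  ultimately have t: "g i = g (i + t)" "t \<ge> 1"
    by simp_all
  have step: "g i = g (i + t)" if "g (Suc i) = g (Suc i + t)" for i t
  proof -
    have "[fib (Suc i) + fib i = fib (Suc i + t) + fib (i + t)] (mod m)"
      "[fib (Suc i) = fib (Suc i + t)] (mod m)"
      using that by (simp_all add: g_def cong_def)
    then have "[fib (Suc i) + fib i = fib (Suc i) + fib (i + t)] (mod m)"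
      by (meson cong_add cong_refl cong_sym cong_trans)
    then have "[fib i = fib (i + t)] (mod m)"
      by (simp only: cong_add_lcancel_nat)
    then show ?thesis
      using that by (simp add: g_def cong_def)
  qed
  have "g 0 = g t"
    using t(1)
  proof (induction i)
    case (Suc i)
    then show ?case using step[of i t] by simp
  qed simp
  then have "\<forall>n. [fib (n + t) = fib n] (mod m)"
    unfolding fib_period_iff by (simp add: g_def cong_def)
  then show ?thesis
    using t(2) by blast
qed

lemma pisano_period:
  assumes "m > 0"
  shows "pisano m \<ge> 1" "[fib (n + pisano m) = fib n] (mod m)"
  using LeastI_ex[OF fib_period_exists[OF assms]] unfolding pisano_def by blast+

lemma pisano_le: "t \<ge> 1 \<Longrightarrow> \<forall>n. [fib (n + t) = fib n] (mod m) \<Longrightarrow> pisano m \<le> t"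
  unfolding pisano_def by (rule Least_le) blast

text \<open>The remainder of \<open>s\<close> modulo the least period again shifts the sequence onto
  itself, so by minimality it is 0.\<close>

lemma pisano_dvd:
  assumes "m > 0" "\<forall>n. [fib (n + s) = fib n] (mod m)"
  shows "pisano m dvd s"
proof -
  have mult: "[fib (n + k * pisano m) = fib n] (mod m)" for n k
  proof (induction k)
    case (Suc k)
    then show ?case
      using pisano_period(2)[OF assms(1), of "n + k * pisano m"] cong_trans
      by (auto simp: algebra_simps)
  qed simp
  have "[fib (n + s mod pisano m) = fib n] (mod m)" for n
  proof -
    have "[fib (n + s mod pisano m) = fib (n + s mod pisano m + s div pisano m * pisano m)] (mod m)"
      by (rule cong_sym[OF mult])
    also have "n + s mod pisano m + s div pisano m * pisano m = n + s"
      by simp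
    also have "[fib (n + s) = fib n] (mod m)"
      using assms by blast
    finally show ?thesis .
  qed
  then have "s mod pisano m = 0"
    using pisano_le[of "s mod pisano m" m] pisano_period(1)[OF assms(1)]
    by (metis One_nat_def Suc_leI linorder_not_less mod_less_divisor not_gr_zero order_less_le_trans zero_less_one)
  then show ?thesis
    by auto
qed

lemma fib_rank:
  assumes "p > 0"
  shows "fib_rank p \<ge> 1" "p dvd fib (fib_rank p)"
proof -
  obtain t where "t \<ge> 1" "p dvd fib t"
    using fib_period_exists[OF assms] unfolding fib_period_iff cong_0_iff by blast
  then show "fib_rank p \<ge> 1" "p dvd fib (fib_rank p)"
    using LeastI[of "\<lambda>n. n \<ge> 1 \<and> p dvd fib n" t] unfolding fib_rank_def by blast+
qed

text \<open>By \<open>fib_gcd\<close>, \<open>p\<close> also divides the Fibonacci number at the gcd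
  of \<open>n\<close> and the rank, which by minimality is the rank itself.\<close>

lemma fib_rank_dvd:
  assumes "p > 0" "p dvd fib n"
  shows "fib_rank p dvd n"
proof -
  have "p dvd fib (gcd (fib_rank p) n)"
    using assms fib_rank by (simp add: fib_gcd)
  moreover have "gcd (fib_rank p) n \<ge> 1"
    using fib_rank(1)[OF assms(1)] by (simp add: Suc_le_eq)
  ultimately have "fib_rank p \<le> gcd (fib_rank p) n"
    using Least_le[of "\<lambda>n. n \<ge> 1 \<and> p dvd fib n"] unfolding fib_rank_def by blast
  then show ?thesis
    using fib_rank(1)[OF assms(1)]
    by (metis gcd_dvd1 gcd_dvd2 dvd_imp_le le_antisym less_le_trans zero_less_one)
qed

section \<open>The Wall-Sun-Sun condition in terms of the rank\<close>

text \<open>A common prime factor would divide \<open>lucas_squared\<close>'s remaining term, which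
  is 4 or -4.\<close>

lemma not_dvd_lucas:
  assumes "prime l" "odd l" "l dvd fib n"
  shows "\<not> l dvd lucas n"
proof
  assume "l dvd lucas n"
  then have "int l dvd (int (lucas n))\<^sup>2 - 5 * (int (fib n))\<^sup>2"
    using assms by (simp add: power2_eq_square)
  then have "int l dvd 4 * (-1) ^ n"
    by (simp add: lucas_squared)
  then have "int l dvd 2 * 2"
    by (cases "even n") simp_all
  moreover have "prime (int l)"
    using assms by simp
  ultimately have "int l dvd 2"
    using prime_dvd_mult_iff by blast
  then have "l = 2"
    using assms by (metis int_dvd_int_iff of_nat_numeral primes_dvd_imp_eq two_is_prime_nat)
  then show False
    using assms by simp
qed

lemma fib_Suc_squared_cong:
  assumes "int k dvd int (fib t)"
  shows "[(int (fib (Suc t)))\<^sup>2 = (-1) ^ t] (mod int k)"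
proof -
  have "int (fib (Suc (Suc t)) * fib t) - (int (fib (Suc t)))\<^sup>2 = - ((-1) ^ t)"
    using fib_Cassini_int[of t] by simp
  then have "(int (fib (Suc t)))\<^sup>2 - (-1) ^ t = int (fib (Suc (Suc t))) * int (fib t)"
    by simp
  then show ?thesis
    using assms by (metis cong_iff_dvd_diff dvd_mult)
qed

text \<open>\<open>fib (2 * m + 1)\<close> is the sum of the squares of \<open>fib (m + 1)\<close>
  and \<open>fib m\<close>; for even \<open>m\<close>, Cassini's identity makes the first square 1
  modulo \<open>k\<close>.\<close>

lemma double_fib_period:
  assumes "even m" "k dvd fib m"
  shows "[fib (n + 2 * m) = fib n] (mod k)"
proof -
  have "k dvd fib (2 * m)"
    using assms by (simp add: fib_double)
  moreover have "[fib (Suc (2 * m)) = 1] (mod k)"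
  proof -
    have "[(int (fib (Suc m)))\<^sup>2 + (int (fib m))\<^sup>2 = 1 + 0] (mod int k)"
      using fib_Suc_squared_cong[of k m] assms
      by (intro cong_add) (auto simp: cong_0_iff power2_eq_square)
    then show ?thesis
      by (simp add: fib_rec_odd add.commute flip: cong_int_iff)
  qed
  ultimately show ?thesis
    using fib_period_iff[of "2 * m" k] by (simp add: cong_0_iff)
qed

text \<open>
  A period \<open>t\<close> modulo \<open>l\<close> is already a period modulo \<open>l\<^sup>2\<close> once \<open>l\<^sup>2\<close> divides \<open>fib t\<close>: by Cassini's
  identity \<open>fib (t + 1)\<close> is a square root of \<open>1\<close> modulo \<open>l\<^sup>2\<close>, and it is not \<open>-1\<close> modulo \<open>l\<close>.
\<close>

lemma fib_Suc_cong_lift: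
  assumes "prime l" "odd l" "l\<^sup>2 dvd fib t" "[fib (Suc t) = 1] (mod l)"
  shows "[fib (Suc t) = 1] (mod l\<^sup>2)"
proof -
  define x where "x = int (fib (Suc t))"
  have l: "prime (int l)" "int l > 2"
    using assms prime_ge_2_nat[of l] by (auto simp: order_le_less)
  have x1: "[x = 1] (mod int l)"
    using assms(4) by (simp add: x_def flip: cong_int_iff)
  have dvd: "(int l)\<^sup>2 dvd int (fib t)"
    using assms(3) by (metis int_dvd_int_iff of_nat_power)
  have "int l dvd int (fib t)"
    by (rule dvd_trans[OF _ dvd]) (simp add: power2_eq_square)
  then have "[x\<^sup>2 = (-1) ^ t] (mod int l)"
    using fib_Suc_squared_cong x_def by blast
  moreover have "[x\<^sup>2 = 1\<^sup>2] (mod int l)"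
    using x1 by (rule cong_pow)
  ultimately have "[1 = (-1) ^ t] (mod int l)"
    by (metis cong_sym cong_trans one_power2)
  \<comment> \<open>For odd \<open>t\<close>, \<open>l\<close> would divide 2.\<close>
  then have "even t"
    using l zdvd_imp_le[of "int l" 2] by (auto simp: cong_iff_dvd_diff minus_one_power_iff split: if_splits)
  then have "[x\<^sup>2 = 1] (mod (int l)\<^sup>2)"
    using fib_Suc_squared_cong[of "l\<^sup>2" t] dvd by (simp add: x_def)
  then have "(int l)\<^sup>2 dvd (x + 1) * (x - 1)"
    by (simp add: cong_iff_dvd_diff power2_eq_square algebra_simps)
  moreover have "\<not> int l dvd x + 1"
  proof
    assume "int l dvd x + 1"
    then have "int l dvd (x + 1) - (x - 1)"
      using x1 unfolding cong_iff_dvd_diff by (rule dvd_diff)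
    then show False
      using l zdvd_imp_le[of "int l" 2] by simp
  qed
  then have "coprime ((int l)\<^sup>2) (x + 1)"
    using l by (simp add: prime_imp_coprime)
  ultimately have "[x = 1] (mod int (l\<^sup>2))"
    by (simp add: coprime_dvd_mult_right_iff cong_iff_dvd_diff)
  then show ?thesis
    unfolding x_def by (metis cong_int_iff of_nat_1)
qed

lemma wall_sun_sun_iff:
  assumes "prime l" "odd l"
  shows "wall_sun_sun_prime l \<longleftrightarrow> l\<^sup>2 dvd fib (fib_rank l)"
proof
  let ?a = "fib_rank l"
  have pos: "l > 0" "l\<^sup>2 > 0"
    using assms(1) prime_gt_0_nat by auto
  note P = pisano_period[OF pos(1)] and P2 = pisano_period[OF pos(2)]
  {
    assume "wall_sun_sun_prime l"
    then have eq: "pisano (l\<^sup>2) = pisano l"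
      by (simp add: wall_sun_sun_prime_def)
    have a: "l dvd fib ?a" "l dvd fib (2 * ?a)"
      using fib_rank(2)[OF pos(1)] by (simp_all add: fib_double)
    \<comment> \<open>The index \<open>2 * ?a\<close> is even whatever the parity of the rank, as
      \<open>double_fib_period\<close> requires.\<close>
    then have "pisano l dvd 2 * (2 * ?a)"
      by (intro pisano_dvd pos allI double_fib_period) simp_all
    then have "fib (pisano l) dvd fib (2 * (2 * ?a))"
      by (metis fib_gcd gcd_nat.absorb_iff1)
    moreover have "l\<^sup>2 dvd fib (pisano l)"
      using P2(2)[of 0] eq by (simp add: cong_0_iff)
    ultimately have "l\<^sup>2 dvd fib ?a * lucas ?a * lucas (2 * ?a)"
      by (metis dvd_trans fib_double)
    moreover have "coprime (l\<^sup>2) (lucas ?a)" "coprime (l\<^sup>2) (lucas (2 * ?a))"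
      using not_dvd_lucas a assms by (simp_all add: prime_imp_coprime)
    ultimately show "l\<^sup>2 dvd fib ?a"
      by (simp add: coprime_dvd_mult_left_iff)
  }
  assume a: "l\<^sup>2 dvd fib ?a"
  have per: "[fib (pisano l) = 0] (mod l)" "[fib (Suc (pisano l)) = 1] (mod l)"
    using P(2) fib_period_iff by blast+
  then have "fib_rank l dvd pisano l"
    using fib_rank_dvd pos by (simp add: cong_0_iff)
  then have "fib (fib_rank l) dvd fib (pisano l)"
    by (metis fib_gcd gcd_nat.absorb_iff1)
  with a have "l\<^sup>2 dvd fib (pisano l)"
    by (rule dvd_trans)
  moreover from this have "[fib (Suc (pisano l)) = 1] (mod l\<^sup>2)"
    using fib_Suc_cong_lift assms per by blast
  ultimately have "pisano (l\<^sup>2) \<le> pisano l"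
    using pisano_le[of "pisano l" "l\<^sup>2"] P(1) unfolding fib_period_iff by (simp add: cong_0_iff)
  \<comment> \<open>A period modulo the square is also one modulo \<open>l\<close>.\<close>
  moreover have "pisano l \<le> pisano (l\<^sup>2)"
    using P2(1) cong_dvd_modulus_nat[OF P2(2), of l] by (intro pisano_le) (auto simp: power2_eq_square)
  ultimately show "wall_sun_sun_prime l"
    using assms by (simp add: wall_sun_sun_prime_def)
qed

section \<open>Valuations of Fibonacci numbers at multiples of m and of their sums of
  squares\<close>

lemma val_of_int: "x \<noteq> 0 \<Longrightarrow> val p (of_int x) = ereal (real (multiplicity (int p) x))"
  by (simp add: val_def)

text \<open>\<open>fib_multiple_squared\<close> controls only squares, so twice the multiplicity is
  compared; the cofactor is \<open>j^2\<close> plus a multiple of \<open>l\<close>, hence prime to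
  \<open>l\<close>.\<close>

lemma multiplicity_fib_multiple:
  assumes "prime l" "even m" "m > 0" "l dvd fib m" "\<not> l dvd j"
  shows "multiplicity (int l) (int (fib (j * m))) = multiplicity (int l) (int (fib m))"
proof -
  have l: "prime (int l)"
    using assms by simp
  have "j > 0"
    using assms by (cases j) auto
  then have nz: "fib m \<noteq> 0" "fib (j * m) \<noteq> 0"
    using assms fib_neq_0_nat by simp_all
  obtain c where c: "(int (fib (j * m)))\<^sup>2 = (int (fib m))\<^sup>2 * ((int j)\<^sup>2 + c * (int (fib m))\<^sup>2)"
    using fib_multiple_squared[OF assms(2)] by blast
  define u where "u = (int j)\<^sup>2 + c * (int (fib m))\<^sup>2"
  have "int l dvd c * (int (fib m))\<^sup>2"
    using assms by (simp add: power2_eq_square)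
  moreover have "\<not> int l dvd (int j)\<^sup>2"
    using assms l by (simp add: prime_dvd_power_iff)
  ultimately have u: "\<not> int l dvd u"
    by (simp add: u_def dvd_add_left_iff)
  then have "u \<noteq> 0"
    by auto
  have "2 * multiplicity (int l) (int (fib (j * m))) = multiplicity (int l) ((int (fib (j * m)))\<^sup>2)"
    using l nz by (simp add: prime_elem_multiplicity_power_distrib)
  also have "\<dots> = multiplicity (int l) ((int (fib m))\<^sup>2 * u)"
    by (simp add: c u_def)
  also have "\<dots> = 2 * multiplicity (int l) (int (fib m))"
    using l nz u \<open>u \<noteq> 0\<close>
    by (simp add: prime_elem_multiplicity_mult_distrib prime_elem_multiplicity_power_distrib
        not_dvd_imp_multiplicity_0)
  finally show ?thesis
    by simp
qed

lemma sum_squares: "6 * (\<Sum>j=1..s. (int j)\<^sup>2) = int s * (int s + 1) * (2 * int s + 1)"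
  by (induction s) (simp_all add: power2_eq_square algebra_simps)

lemma multiplicity_fib_sum:
  assumes "prime l" "l = 2 * s + 1" "even m" "m > 0" "l dvd fib m"
  shows "\<exists>S. (\<Sum>j=1..s. (int (fib (j * m)))\<^sup>2) = (int (fib m))\<^sup>2 * S \<and> S \<noteq> 0
    \<and> multiplicity (int l) S = (if l = 3 then 0 else 1)"
proof -
  have l: "prime (int l)"
    using assms(1) by simp
  have "l \<ge> 3"
    using prime_ge_2_nat[OF assms(1)] assms(2) by presburger
  define f where "f = int (fib m)"
  obtain c where c: "(int (fib (j * m)))\<^sup>2 = f\<^sup>2 * ((int j)\<^sup>2 + c j * f\<^sup>2)" for j
    unfolding f_def using fib_multiple_squared[OF assms(3)] by metis
  define S where "S = (\<Sum>j=1..s. (int j)\<^sup>2) + (\<Sum>j=1..s. c j) * f\<^sup>2"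
  have sum: "(\<Sum>j=1..s. (int (fib (j * m)))\<^sup>2) = f\<^sup>2 * S"
    by (simp add: c S_def sum.distrib sum_distrib_left sum_distrib_right distrib_left)
  obtain w where w: "f = int l * w"
    using assms f_def by (metis dvdE of_nat_mult)
  \<comment> \<open>Multiplying by 6 clears the denominator of the sum of squares. As
    \<open>2 * s + 1 = l\<close> and \<open>f = l * w\<close>, a factor \<open>l\<close> splits off
    from \<open>6 * S\<close>, and the cofactor \<open>v\<close> is \<open>s * (s + 1)\<close>
    modulo \<open>l\<close>.\<close>
  define v where "v = int s * (int s + 1) + 6 * (\<Sum>j=1..s. c j) * int l * w\<^sup>2"
  have "6 * S = 6 * (\<Sum>j=1..s. (int j)\<^sup>2) + 6 * (\<Sum>j=1..s. c j) * f\<^sup>2"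
    by (simp add: S_def algebra_simps)
  also have "\<dots> = int l * v"
    unfolding sum_squares by (simp add: v_def w assms(2) power2_eq_square algebra_simps)
  finally have S: "6 * S = int l * v" .
  have "\<not> l dvd s" "\<not> l dvd s + 1"
    using assms(2) \<open>l \<ge> 3\<close> by (auto dest!: dvd_imp_le)
  then have "\<not> int l dvd int s * (int s + 1)"
    using l by (metis int_dvd_int_iff of_nat_1 of_nat_add prime_dvd_multD)
  then have v: "\<not> int l dvd v"
    by (simp add: v_def dvd_add_left_iff)
  then have "v \<noteq> 0"
    by auto
  then have "S \<noteq> 0"
    using S \<open>l \<ge> 3\<close> by auto
  have S1: "multiplicity (int l) (6 * S) = 1"
    unfolding S using v \<open>v \<noteq> 0\<close> l
    by (simp add: prime_elem_multiplicity_mult_distrib not_dvd_imp_multiplicity_0)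
  have S2: "multiplicity (int l) (6 * S) = multiplicity (int l) 6 + multiplicity (int l) S"
    using \<open>S \<noteq> 0\<close> l by (intro prime_elem_multiplicity_mult_distrib) auto
  \<comment> \<open>The factor 6 absorbs the single \<open>l\<close> exactly when
    \<open>l = 3\<close>; this is the source of \<open>h\<close>.\<close>
  have six: "multiplicity (int l) 6 = (if l = 3 then 1 else 0)"
  proof (cases "l = 3")
    case True
    then show ?thesis
      using multiplicity_eqI[of "3::int" 1 6] by simp
  next
    case False
    have "\<not> int l dvd 6"
    proof
      assume "int l dvd 6"
      then have "l dvd 2 * 3"
        by presburger
      then have "l dvd 2 \<or> l dvd 3"
        using assms(1) prime_dvd_mult_iff by blast
      then show False
        using False \<open>l \<ge> 3\<close> by (auto dest!: dvd_imp_le)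
    qed
    then show ?thesis
      using False by (simp add: not_dvd_imp_multiplicity_0)
  qed
  then show ?thesis
    using S1 S2 sum \<open>S \<noteq> 0\<close> f_def by (intro exI[of _ S]) auto
qed

section \<open>Both valuations and the divisibility criteria\<close>

theorem corollary5p5:
  fixes l \<alpha> \<rho> h :: nat and r :: ereal and F L :: int
  assumes "prime l" and "odd l" and "l \<noteq> 5"
    and "\<alpha> = fib_rank l"
    and "\<rho> = \<alpha> div gcd \<alpha> 2"
    and "r = val l (of_nat (fib \<alpha>))"
    and "h = (if l = 3 then 1 else 0)"
    and "F = int (fib (2 * l * \<rho>)) - int l * int (fib (2 * \<rho>))"
    and "L = int (lucas (2 * l * \<rho>)) - int (lucas (2 * \<rho>))"
  shows "val l (of_int F) = 3 * r + 1 - ereal (real h)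
       \<and> val l (of_int L) = 2 * r
       \<and> (wall_sun_sun_prime l \<longleftrightarrow> int l ^ (7 - h) dvd F)
       \<and> (int l ^ (7 - h) dvd F \<longleftrightarrow> int l ^ 4 dvd L)
       \<and> (int l ^ 4 dvd L \<longleftrightarrow> int l ^ (5 - h) dvd F)
       \<and> (int l ^ (5 - h) dvd F \<longleftrightarrow> int l ^ 3 dvd L)
       \<and> r = (val l (of_int F) + ereal (real h) - 1) / 3
       \<and> r = val l (of_int L) / 2"
proof -
  have l: "prime (int l)" "prime_elem (int l)" "l > 0"
    using assms(1) prime_gt_0_nat by auto
  have "l \<ge> 3"
    using prime_ge_2_nat[OF assms(1)] assms(2) by (cases "l = 2") auto
  obtain s where s: "l = 2 * s + 1"
    using assms(2) by (auto elim: oddE)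
  have \<alpha>: "\<alpha> \<ge> 1" "l dvd fib \<alpha>"
    using fib_rank[OF l(3)] assms(4) by simp_all
  define m where "m = 2 * \<rho>"
  have m_cases: "m = (if even \<alpha> then \<alpha> else 2 * \<alpha>)"
  proof (cases "even \<alpha>")
    case True
    then show ?thesis
      by (simp add: m_def assms(5) gcd_nat.absorb2)
  next
    case False
    then show ?thesis
      by (simp add: m_def assms(5) coprime_iff_gcd_eq_1[symmetric])
  qed
  have m: "even m" "m > 0"
    using \<alpha> m_cases by (auto simp: m_def)
  have lm: "l dvd fib m"
    using \<alpha>(2) by (simp add: m_cases fib_double)
  define R where "R = multiplicity (int l) (int (fib m))"
  have nz: "fib m \<noteq> 0" "fib \<alpha> \<noteq> 0"
    using m \<alpha> fib_neq_0_nat by simp_all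
  have lucas_nz: "lucas \<alpha> \<noteq> 0"
    using not_dvd_lucas[OF assms(1,2) \<alpha>(2)] by (intro notI) simp
  \<comment> \<open>Doubling an odd \<alpha> only multiplies \<open>fib \<alpha>\<close> by
    \<open>lucas \<alpha>\<close>, which is prime to \<open>l\<close>.\<close>
  have R: "multiplicity (int l) (int (fib \<alpha>)) = R"
    using not_dvd_lucas[OF assms(1,2) \<alpha>(2)] l nz lucas_nz
    by (simp add: R_def m_cases fib_double prime_elem_multiplicity_mult_distrib
        not_dvd_imp_multiplicity_0)
  then have r: "r = ereal (real R)"
    using assms(6) nz val_of_int[of "int (fib \<alpha>)" l] by simp
  have le_R: "l ^ k dvd fib \<alpha> \<longleftrightarrow> k \<le> R" for k
    using power_dvd_iff_le_multiplicity[of "int (fib \<alpha>)" "int l" k] R nz \<open>l \<ge> 3\<close>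
    by (simp flip: of_nat_power)
  have "R \<ge> 1"
    using le_R[of 1] \<alpha>(2) by simp
  have five: "multiplicity (int l) 5 = 0"
  proof -
    have "prime (5::int)"
      by simp
    then have "\<not> int l dvd 5"
      using assms(3) l(1) primes_dvd_imp_eq[of "int l" 5] by auto
    then show ?thesis
      by (rule not_dvd_imp_multiplicity_0)
  qed
  have idx: "2 * l * \<rho> = (2 * s + 1) * m"
    by (simp add: m_def s)

  obtain S where S: "(\<Sum>j=1..s. (int (fib (j * m)))\<^sup>2) = (int (fib m))\<^sup>2 * S" "S \<noteq> 0"
    "multiplicity (int l) S = (if l = 3 then 0 else 1)"
    using multiplicity_fib_sum[OF assms(1) s m(1,2) lm] by blast
  have F: "F = 5 * (int (fib m) ^ 3 * S)"
  proof -
    have "F = 5 * int (fib m) * (\<Sum>j=1..s. (int (fib (j * m)))\<^sup>2)"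
      unfolding assms(8) idx m_def[symmetric] fib_odd_multiple[OF m(1)]
      by (simp add: s algebra_simps)
    then show ?thesis
      unfolding S(1) by (simp add: power2_eq_square power3_eq_cube)
  qed
  have F_nz: "F \<noteq> 0"
    using F S nz by simp
  have F_mult: "multiplicity (int l) F = 3 * R + 1 - h"
    unfolding F using S nz l five
    by (simp add: prime_elem_multiplicity_mult_distrib prime_elem_multiplicity_power_distrib
        R_def assms(7))

  have L: "L = 5 * (int (fib ((s + 1) * m)) * int (fib (s * m)))"
    unfolding assms(9) idx m_def[symmetric] lucas_odd_multiple[OF m(1)] by simp
  have "s \<ge> 1"
    using s \<open>l \<ge> 3\<close> by simp
  then have nz': "fib (s * m) \<noteq> 0" "fib ((s + 1) * m) \<noteq> 0"
    using m fib_neq_0_nat by simp_all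
  then have L_nz: "L \<noteq> 0"
    using L by simp
  have "\<not> l dvd s" "\<not> l dvd s + 1"
    using s \<open>s \<ge> 1\<close> by (auto dest!: dvd_imp_le)
  then have "multiplicity (int l) (int (fib (s * m))) = R"
    "multiplicity (int l) (int (fib ((s + 1) * m))) = R"
    unfolding R_def using multiplicity_fib_multiple[OF assms(1) m(1,2) lm] by blast+
  then have L_mult: "multiplicity (int l) L = 2 * R"
    unfolding L using nz' l five
    by (simp add: prime_elem_multiplicity_mult_distrib)

  \<comment> \<open>Since \<open>R \<ge> 1\<close> and \<open>h\<close> is 0 or 1, the subtraction
    on naturals does not truncate.\<close>
  have F_val: "val l (of_int F) = ereal (3 * real R + 1 - real h)"
    unfolding val_of_int[OF F_nz] F_mult using \<open>R \<ge> 1\<close> assms(7) by (simp add: of_nat_diff)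
  have L_val: "val l (of_int L) = ereal (2 * real R)"
    unfolding val_of_int[OF L_nz] L_mult by simp
  have F_dvd: "int l ^ k dvd F \<longleftrightarrow> k \<le> 3 * R + 1 - h"
    and L_dvd: "int l ^ k dvd L \<longleftrightarrow> k \<le> 2 * R" for k
    using power_dvd_iff_le_multiplicity[of F "int l" k] power_dvd_iff_le_multiplicity[of L "int l" k]
      F_nz L_nz \<open>l \<ge> 3\<close> by (simp_all add: F_mult L_mult)
  have "wall_sun_sun_prime l \<longleftrightarrow> 2 \<le> R"
    using wall_sun_sun_iff[OF assms(1,2)] assms(4) le_R by simp
  moreover have "h \<le> 1"
    using assms(7) by simp
  \<comment> \<open>From \<open>R = 1\<close> to \<open>R = 2\<close> the multiplicities jump from
    \<open>4 - h\<close> to \<open>7 - h\<close> for \<open>F\<close> and from 2 to 4 for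
    \<open>L\<close>, so every exponent within these gaps tests \<open>R \<ge> 2\<close>.\<close>
  then have "7 - h \<le> 3 * R + 1 - h \<longleftrightarrow> 2 \<le> R" "5 - h \<le> 3 * R + 1 - h \<longleftrightarrow> 2 \<le> R"
    "4 \<le> 2 * R \<longleftrightarrow> 2 \<le> R" "3 \<le> 2 * R \<longleftrightarrow> 2 \<le> R"
    using \<open>R \<ge> 1\<close> by linarith+
  ultimately show ?thesis
    unfolding F_dvd L_dvd F_val L_val r by (simp add: one_ereal_def)
qed

end
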